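(* Let $B$ be a four-dimensional open ball. There is no observer independent measure $F$ of strength of gravity on $B$ (that is, no map $F$ from the set of all Lorentzian metrics on $B$ admitting a timelike Killing vector field to the set of all scalar fields on $B$) such that for every Lorentzian metric $g$ on $B$ admitting a timelike Killing vector field, and for every timelike Killing vector field $K$ of $g$ on $B$, the four-acceleration $A$ of the observers defined by $K$ satisfies $$A\,F(g)<0$$ at every point of $B$ at which $A\neq 0$.
   Context: Conventions: $B$ is a four-dimensional open ball (e.g. the open unit ball in $\mathbb{R}^4$), regarded as a smooth manifold. A Lorentzian metric $g$ on $B$ is a smooth metric of signature $(-,+,+,+)$; metrics are not required to satisfy any field equations. A scalar field on $B$ is a smooth real-valued function on $B$. A vector field $K$ on $B$ is a Killing vector field of $g$ if $\mathcal{L}_K g=0$ (Lie derivative); it is timelike if $g(K,K)<0$ at every point of $B$. Observer independent measure of strength of gravity: a map $F$ whose domain is the set of all Lorentzian metrics on $B$ that admit a timelike Killing vector field on $B$, and whose codomain is the set of all scalar fields on $B$. Thus $F(g)$ is a scalar field that depends only on $g$, and not on any choice of Killing vector field of $g$. Four-acceleration: given a metric $g$ and a timelike Killing vector field $K$ of $g$, the observers defined by $K$ are those whose world lines are the integral curves of $K$. Their four-velocity is the vector field $U=\frac{1}{\sqrt{|g(K,K)|}}K$, and their four-acceleration is the vector field $A=\nabla_U U$, where $\nabla$ is the Levi-Civita connection of $g$. For a vector field $X$ and a scalar field $f$, $Xf$ denotes the derivative of $f$ along $X$ (in coordinates $Xf=X^\alpha\,\partial f/\partial x^\alpha$); thus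 $A\,F(g)$ is the derivative of the function $F(g)$ in the direction of $A$. *)

theory Defs
  imports "HOL-Analysis.Analysis"
begin

definition partial :: "'n::finite \<Rightarrow> (real^'n \<Rightarrow> 'b::real_normed_vector) \<Rightarrow> real^'n \<Rightarrow> 'b"
  where "partial i f x = frechet_derivative f (at x) (axis i 1)"

text \<open>\<open>C_on k S f\<close>: \<open>f\<close> is of class \<open>C\<^sup>k\<close> on \<open>S\<close>. The domain \<open>S\<close> is meant to be open.\<close>

primrec C_on :: "nat \<Rightarrow> (real^'n::finite) set \<Rightarrow> (real^'n \<Rightarrow> 'b::real_normed_vector) \<Rightarrow> bool" where
  "C_on 0 S f \<longleftrightarrow> continuous_on S f"
| "C_on (Suc k) S f \<longleftrightarrow> f differentiable_on S \<and> (\<forall>i. C_on k S (partial i f))"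

definition smooth_on :: "(real^'n::finite) set \<Rightarrow> (real^'n \<Rightarrow> 'b::real_normed_vector) \<Rightarrow> bool"
  where "smooth_on S f \<longleftrightarrow> (\<forall>k. C_on k S f)"

text \<open>
  Fields on an open set \<open>B\<close> are given by their components in the standard coordinates. They are
  \<open>extensional\<close>, i.e. equal to \<open>undefined\<close> outside \<open>B\<close>, so that two of them are equal as HOL
  functions iff they agree on \<open>B\<close>. In particular, a map applied to a metric cannot
  depend on anything but the values of the metric on \<open>B\<close>.
\<close>

definition smooth_fields :: "(real^'n::finite) set \<Rightarrow> (real^'n \<Rightarrow> 'b::real_normed_vector) set"
  where "smooth_fields B = {f \<in> extensional B. smooth_on B f}"

abbreviation scalar_fields :: "(real^4) set \<Rightarrow> (real^4 \<Rightarrow> real) set"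
  where "scalar_fields \<equiv> smooth_fields"

abbreviation vector_fields :: "(real^4) set \<Rightarrow> (real^4 \<Rightarrow> real^4) set"
  where "vector_fields \<equiv> smooth_fields"

text \<open>\<open>minkowski\<close> is \<open>diag(-1,1,1,1)\<close>; the elements of the index type \<open>4\<close> are \<open>0, 1, 2, 3\<close>.\<close>

definition minkowski :: "real^4^4"
  where "minkowski = (\<chi> i j. if i = j then (if i = 0 then -1 else 1) else 0)"

text \<open>
  A symmetric bilinear form with matrix \<open>G\<close> has signature \<open>(-,+,+,+)\<close> iff it is \<open>diag(-1,1,1,1)\<close>
  in some basis; the columns of \<open>P\<close> are that basis.
\<close>

definition lorentzian_form :: "real^4^4 \<Rightarrow> bool"
  where "lorentzian_form G \<longleftrightarrow>
    transpose G = G \<and> (\<exists>P. invertible P \<and> transpose P ** G ** P = minkowski)"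

definition lorentzian_metrics :: "(real^4) set \<Rightarrow> (real^4 \<Rightarrow> real^4^4) set"
  where "lorentzian_metrics B = {g \<in> smooth_fields B. \<forall>x\<in>B. lorentzian_form (g x)}"

definition metric_prod :: "(real^4 \<Rightarrow> real^4^4) \<Rightarrow> (real^4 \<Rightarrow> real^4) \<Rightarrow> (real^4 \<Rightarrow> real^4) \<Rightarrow> real^4 \<Rightarrow> real"
  where "metric_prod g X Y x = (\<Sum>i\<in>UNIV. \<Sum>j\<in>UNIV. g x $ i $ j * X x $ i * Y x $ j)"

definition vf_deriv :: "(real^4 \<Rightarrow> real^4) \<Rightarrow> (real^4 \<Rightarrow> real) \<Rightarrow> real^4 \<Rightarrow> real"
  where "vf_deriv X f x = (\<Sum>i\<in>UNIV. X x $ i * partial i f x)"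

text \<open>Components of \<open>\<L>\<^sub>K g\<close>.\<close>

definition lie_deriv_metric :: "(real^4 \<Rightarrow> real^4) \<Rightarrow> (real^4 \<Rightarrow> real^4^4) \<Rightarrow> real^4 \<Rightarrow> real^4^4"
  where "lie_deriv_metric K g x = (\<chi> i j.
    vf_deriv K (\<lambda>y. g y $ i $ j) x
    + (\<Sum>k\<in>UNIV. g x $ k $ j * partial i (\<lambda>y. K y $ k) x)
    + (\<Sum>k\<in>UNIV. g x $ i $ k * partial j (\<lambda>y. K y $ k) x))"

definition killing_fields :: "(real^4) set \<Rightarrow> (real^4 \<Rightarrow> real^4^4) \<Rightarrow> (real^4 \<Rightarrow> real^4) set"
  where "killing_fields B g = {K \<in> vector_fields B. \<forall>x\<in>B. lie_deriv_metric K g x = 0}"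

definition timelike_killing_fields :: "(real^4) set \<Rightarrow> (real^4 \<Rightarrow> real^4^4) \<Rightarrow> (real^4 \<Rightarrow> real^4) set"
  where "timelike_killing_fields B g = {K \<in> killing_fields B g. \<forall>x\<in>B. metric_prod g K K x < 0}"

text \<open>\<open>christoffel g k i j x\<close> is \<open>\<Gamma>\<^sup>k\<^sub>i\<^sub>j\<close> at \<open>x\<close>, for the Levi-Civita connection of \<open>g\<close>.\<close>

definition christoffel :: "(real^4 \<Rightarrow> real^4^4) \<Rightarrow> 4 \<Rightarrow> 4 \<Rightarrow> 4 \<Rightarrow> real^4 \<Rightarrow> real"
  where "christoffel g k i j x = (1/2) * (\<Sum>l\<in>UNIV. matrix_inv (g x) $ k $ l *
    (partial i (\<lambda>y. g y $ j $ l) x + partial j (\<lambda>y. g y $ i $ l) x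
      - partial l (\<lambda>y. g y $ i $ j) x))"

text \<open>\<open>\<nabla>\<^sub>X Y\<close>.\<close>

definition cov_deriv :: "(real^4 \<Rightarrow> real^4^4) \<Rightarrow> (real^4 \<Rightarrow> real^4) \<Rightarrow> (real^4 \<Rightarrow> real^4) \<Rightarrow> real^4 \<Rightarrow> real^4"
  where "cov_deriv g X Y x = (\<chi> k. vf_deriv X (\<lambda>y. Y y $ k) x
    + (\<Sum>i\<in>UNIV. \<Sum>j\<in>UNIV. christoffel g k i j x * X x $ i * Y x $ j))"

definition four_velocity :: "(real^4 \<Rightarrow> real^4^4) \<Rightarrow> (real^4 \<Rightarrow> real^4) \<Rightarrow> real^4 \<Rightarrow> real^4"
  where "four_velocity g K x = (1 / sqrt \<bar>metric_prod g K K x\<bar>) *\<^sub>R K x"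

definition four_acceleration :: "(real^4 \<Rightarrow> real^4^4) \<Rightarrow> (real^4 \<Rightarrow> real^4) \<Rightarrow> real^4 \<Rightarrow> real^4"
  where "four_acceleration g K = cov_deriv g (four_velocity g K) (four_velocity g K)"

definition stationary_metrics :: "(real^4) set \<Rightarrow> (real^4 \<Rightarrow> real^4^4) set"
  where "stationary_metrics B = {g \<in> lorentzian_metrics B. timelike_killing_fields B g \<noteq> {}}"

definition observer_independent_measures ::
    "(real^4) set \<Rightarrow> ((real^4 \<Rightarrow> real^4^4) \<Rightarrow> (real^4 \<Rightarrow> real)) set"
  where "observer_independent_measures B = stationary_metrics B \<rightarrow> scalar_fields B"

end

theory Submission
  imports Defs
begin

text \<open>
  Minkowski space admits, for every small \<open>s\<close>, the timelike Killing field
  \<open>\<partial>\<^sub>t + s (x \<partial>\<^sub>t + t \<partial>\<^sub>x)\<close>, a boost about the distant event \<open>x = -1/s\<close>. Its observers have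
  acceleration \<open>s \<partial>\<^sub>x\<close> at the origin, taken to be the centre of the ball, so the fields for \<open>s\<close> and \<open>-s\<close> accelerate in
  opposite directions there and no function can decrease along both.
\<close>

lemma partial_eqI:
  assumes "(f has_derivative f') (at x)"
  shows "partial i f x = f' (axis i 1)"
  using frechet_derivative_at[OF assms] by (simp add: partial_def)

text \<open>\<open>frechet_derivative\<close> is a choice among the derivatives at a point.
  Functions that agree near \<open>x\<close> have the same derivatives there, so the choice is the
  same, even where there is none to choose.\<close>

lemma partial_cong_open:
  assumes "open S" "x \<in> S" "\<And>y. y \<in> S \<Longrightarrow> f y = h y"
  shows "partial i f x = partial i h x"
proof -
  have "(f has_derivative D) (at x) \<longleftrightarrow> (h has_derivative D) (at x)" for D
    using assms by (metis has_derivative_transform_within_open)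
  then show ?thesis
    by (simp add: partial_def frechet_derivative_def)
qed

lemma partial_const [simp]: "partial i (\<lambda>_. a) x = 0"
  by (rule partial_eqI[where f' = "\<lambda>_. 0"]) simp

lemma vf_deriv_axis: "X x = a *\<^sub>R axis i 1 \<Longrightarrow> vf_deriv X f x = a * partial i f x"
  by (simp add: vf_deriv_def axis_def if_distrib if_distribR cong: if_cong)

text \<open>Fields are \<open>undefined\<close> outside \<open>B\<close>, so their smoothness has to
  come from formulas valid on the whole space. Openness makes the partial derivatives agree on
  \<open>S\<close> as well, which keeps the induction going.\<close>

lemma C_on_cong_open:
  assumes "open S" "\<And>x. x \<in> S \<Longrightarrow> f x = h x"
  shows "C_on k S f \<longleftrightarrow> C_on k S h"
  using assms(2)
proof (induction k arbitrary: f h)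
  case 0
  then show ?case by (auto intro!: continuous_on_cong)
next
  case (Suc k)
  have "f differentiable_on S \<longleftrightarrow> h differentiable_on S"
    using Suc.prems unfolding differentiable_on_def differentiable_def
    by (metis has_derivative_transform)
  moreover have "C_on k S (partial i f) \<longleftrightarrow> C_on k S (partial i h)" for i
    using partial_cong_open[OF assms(1) _ Suc.prems] by (intro Suc.IH) auto
  ultimately show ?case by simp
qed

lemma C_on_const: "C_on k S (\<lambda>_. a)"
proof (induction k arbitrary: a)
  case (Suc k)
  have "partial i (\<lambda>_. a) = (\<lambda>_. 0)" for i :: 'a
    by (simp add: fun_eq_iff)
  then show ?case using Suc by (simp add: differentiable_on_const)
qed simp

text \<open>The derivative is \<open>L\<close> at every point, so the first partial derivatives are
  constant and \<open>C_on_const\<close> takes over after one step.\<close>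

lemma C_on_affine:
  assumes "bounded_linear L"
  shows "C_on k S (\<lambda>x. a + L x)"
proof (cases k)
  case 0
  then show ?thesis
    using assms by (simp only: C_on.simps) (intro continuous_on_add continuous_on_const linear_continuous_on)
next
  case (Suc m)
  have der: "((\<lambda>x. a + L x) has_derivative L) (at x within T)" for x T
    using assms by (auto intro!: derivative_eq_intros bounded_linear_imp_has_derivative)
  then have "partial i (\<lambda>x. a + L x) = (\<lambda>_. L (axis i 1))" for i
    by (auto simp: fun_eq_iff intro: partial_eqI)
  moreover have "(\<lambda>x. a + L x) differentiable_on S"
    using der unfolding differentiable_on_def differentiable_def by blast
  ultimately show ?thesis
    using Suc by (simp add: C_on_const)
qed

lemma restrict_smooth_fields:
  assumes "open B" "smooth_on B f"
  shows "restrict f B \<in> smooth_fields B"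
  using assms C_on_cong_open[of B "restrict f B" f]
  by (simp add: smooth_fields_def smooth_on_def)

lemma lorentzian_form_minkowski: "lorentzian_form minkowski"
proof -
  have sym: "transpose minkowski = minkowski"
    by (auto simp: transpose_def minkowski_def vec_eq_iff)
  moreover have "invertible (mat 1 :: real^4^4)"
    by (simp add: invertible_def)
  moreover have "transpose (mat 1) ** minkowski ** mat 1 = minkowski"
    by (simp add: transpose_mat)
  ultimately show ?thesis
    unfolding lorentzian_form_def by blast
qed

definition flat_metric :: "(real^4) set \<Rightarrow> real^4 \<Rightarrow> real^4^4"
  where "flat_metric B = restrict (\<lambda>_. minkowski) B"

lemma flat_metric_lorentzian:
  assumes "open B"
  shows "flat_metric B \<in> lorentzian_metrics B"
  using restrict_smooth_fields[OF assms, of "\<lambda>_. minkowski"]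
  by (simp add: flat_metric_def lorentzian_metrics_def lorentzian_form_minkowski
      smooth_on_def C_on_const)

lemma partial_flat_metric:
  assumes "open B" "x \<in> B"
  shows "partial l (\<lambda>y. flat_metric B y $ i $ j) x = 0"
  using partial_cong_open[OF assms, of "\<lambda>y. flat_metric B y $ i $ j" "\<lambda>_. minkowski $ i $ j"]
  by (simp add: flat_metric_def)

text \<open>Indices 0 and 1 stand for \<open>t\<close> and \<open>x\<close>. Positions are measured
  from \<open>c\<close>, so that the value at \<open>c\<close> is \<open>\<partial>\<^sub>t\<close>
  for every \<open>s\<close>.\<close>

definition boost :: "real^4 \<Rightarrow> real \<Rightarrow> real^4 \<Rightarrow> real^4"
  where "boost c s x = axis 0 1 + s *\<^sub>R ((x - c) $ 1 *\<^sub>R axis 0 1 + (x - c) $ 0 *\<^sub>R axis 1 1)"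

lemma boost_nth:
  "boost c s x $ k = (if k = 0 then 1 + s * (x $ 1 - c $ 1)
    else if k = 1 then s * (x $ 0 - c $ 0) else 0)"
  by (simp add: boost_def axis_def)

lemma smooth_on_boost: "smooth_on B (boost c s)"
proof -
  let ?L = "\<lambda>x::real^4. s *\<^sub>R (x $ 1 *\<^sub>R axis 0 1 + x $ 0 *\<^sub>R axis 1 1) :: real^4"
  have L: "bounded_linear ?L"
    by (intro bounded_linear_add bounded_linear_const_scaleR bounded_linear_scaleR_const
        bounded_linear_vec_nth)
  have "boost c s = (\<lambda>x. (axis 0 1 - ?L c) + ?L x)"
    by (auto simp: boost_def fun_eq_iff algebra_simps)
  with C_on_affine[OF L] show ?thesis
    by (simp only: smooth_on_def simp_thms)
qed

lemma boost_nth_has_derivative: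
  "((\<lambda>y. boost c s y $ k) has_derivative
    (\<lambda>h. if k = 0 then s * h $ 1 else if k = 1 then s * h $ 0 else 0)) (at x)"
  unfolding boost_nth
  by (cases "k = 0"; cases "k = 1")
    (auto intro!: derivative_eq_intros bounded_linear_imp_has_derivative bounded_linear_vec_nth)

lemma partial_boost:
  "partial i (\<lambda>y. boost c s y $ k) x =
    (if k = 0 \<and> i = 1 \<or> k = 1 \<and> i = 0 then s else 0)"
  using partial_eqI[OF boost_nth_has_derivative, of i c s k x] by (auto simp: axis_def)

lemma metric_prod_boost:
  assumes "x \<in> B"
  shows "metric_prod (flat_metric B) (restrict (boost c s) B) (restrict (boost c s) B) x
    = (s * (x $ 0 - c $ 0))\<^sup>2 - (1 + s * (x $ 1 - c $ 1))\<^sup>2"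
  using assms
  by (simp add: metric_prod_def flat_metric_def minkowski_def sum_4 boost_nth power2_eq_square
      algebra_simps)

text \<open>The bound keeps the terms coming from the boost below 1/2 in absolute value on the ball,
  so the \<open>t\<close> component stays above 1/2 and dominates the \<open>x\<close>
  component.\<close>

lemma boost_timelike_killing:
  assumes "\<bar>s\<bar> * r < 1 / 2"
  shows "restrict (boost c s) (ball c r) \<in> timelike_killing_fields (ball c r) (flat_metric (ball c r))"
proof -
  let ?B = "ball c r"
  let ?K = "restrict (boost c s) ?B"
  have partial_K: "partial i (\<lambda>y. ?K y $ k) x = partial i (\<lambda>y. boost c s y $ k) x"
    if "x \<in> ?B" for i k x
    using that by (intro partial_cong_open[of ?B]) auto
  \<comment> \<open>As the metric is constant, only the derivatives of the field contribute. Its two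
    nonzero partial derivatives both equal \<open>s\<close>, and the minus sign in
    \<open>minkowski\<close> makes them cancel. The metric stays folded in the first call so that
    \<open>partial_flat_metric\<close> applies.\<close>
  have "lie_deriv_metric ?K (flat_metric ?B) x = 0" if "x \<in> ?B" for x
    using that
    by (simp add: lie_deriv_metric_def vec_eq_iff vf_deriv_def partial_flat_metric partial_K
        partial_boost forall_4 sum_4 del: restrict_apply) (simp add: flat_metric_def minkowski_def)
  moreover have "metric_prod (flat_metric ?B) ?K ?K x < 0" if x: "x \<in> ?B" for x
  proof -
    define u where "u = s * (x $ 1 - c $ 1)"
    define v where "v = s * (x $ 0 - c $ 0)"
    have small: "\<bar>s * (x $ i - c $ i)\<bar> < 1 / 2" for i
    proof -
      have "\<bar>x $ i - c $ i\<bar> \<le> r"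
        using component_le_norm_cart[of "x - c" i] x by (simp add: dist_norm norm_minus_commute)
      then have "\<bar>s\<bar> * \<bar>x $ i - c $ i\<bar> \<le> \<bar>s\<bar> * r"
        by (intro mult_left_mono) auto
      with assms show ?thesis by (simp add: abs_mult)
    qed
    have "\<bar>v\<bar> < \<bar>1 + u\<bar>"
      using small[of 0] small[of 1] unfolding u_def v_def by linarith
    then have "v\<^sup>2 < (1 + u)\<^sup>2"
      by (metis abs_le_square_iff not_less)
    then show ?thesis
      by (simp add: metric_prod_boost[OF x] u_def v_def)
  qed
  moreover have "?K \<in> vector_fields ?B"
    by (intro restrict_smooth_fields smooth_on_boost) simp
  ultimately show ?thesis
    by (simp add: timelike_killing_fields_def killing_fields_def)
qed

text \<open>The Christoffel symbols vanish and the four-velocity at \<open>c\<close> is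
  \<open>\<partial>\<^sub>t\<close>, so the acceleration there is the \<open>t\<close> derivative of
  the components of the four-velocity.\<close>

lemma boost_four_acceleration:
  assumes "r > 0"
  shows "four_acceleration (flat_metric (ball c r)) (restrict (boost c s) (ball c r)) c
    = s *\<^sub>R axis 1 1"
proof -
  let ?B = "ball c r"
  let ?g = "flat_metric ?B"
  let ?U = "four_velocity ?g (restrict (boost c s) ?B)"
  define N where "N y = (s * (y $ 0 - c $ 0))\<^sup>2 - (1 + s * (y $ 1 - c $ 1))\<^sup>2" for y :: "real^4"
  have c: "c \<in> ?B" using assms by simp
  have U: "?U y = (1 / sqrt \<bar>N y\<bar>) *\<^sub>R boost c s y" if "y \<in> ?B" for y
    using that by (simp add: four_velocity_def metric_prod_boost[OF that] N_def)
  have Uc: "?U c = axis 0 1"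
    using U[OF c] by (simp add: N_def boost_def)
  have "partial 0 (\<lambda>y. ?U y $ k) c = s * axis 1 1 $ k" for k
  proof -
    have N: "(N has_derivative (\<lambda>h. - 2 * s * h $ 1)) (at c)"
      unfolding N_def[abs_def]
      by (auto intro!: derivative_eq_intros bounded_linear_imp_has_derivative bounded_linear_vec_nth)
    have Nc: "N c = -1" by (simp add: N_def)
    \<comment> \<open>\<open>N\<close> is negative at \<open>c\<close>, so taking the absolute value
      flips the sign of the derivative.\<close>
    have absN: "((\<lambda>y. \<bar>N y\<bar>) has_derivative (\<lambda>h. 2 * s * h $ 1)) (at c)"
      using has_derivative_compose[OF N has_derivative_norm] by (simp add: Nc)
    have "((\<lambda>y. (1 / sqrt \<bar>N y\<bar>) * boost c s y $ k) has_derivative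
      (\<lambda>h. (if k = 0 then s * h $ 1 else if k = 1 then s * h $ 0 else 0)
        - boost c s c $ k * (s * h $ 1))) (at c)"
      by (auto intro!: derivative_eq_intros absN boost_nth_has_derivative simp: Nc)
    note D = partial_eqI[OF this, of 0]
    have "partial 0 (\<lambda>y. ?U y $ k) c = partial 0 (\<lambda>y. (1 / sqrt \<bar>N y\<bar>) * boost c s y $ k) c"
      using U c by (intro partial_cong_open[of ?B]) auto
    \<comment> \<open>To first order at \<open>c\<close> the normalising factor varies only in the
      \<open>x\<close> direction. Along \<open>t\<close> only the \<open>x\<close> component of the
      boost changes, at rate \<open>s\<close>.\<close>
    also have "\<dots> = s * axis 1 1 $ k"
      unfolding D by (simp add: boost_nth axis_def)
    finally show ?thesis .
  qed
  moreover have "vf_deriv ?U f c = partial 0 f c" for f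
    using vf_deriv_axis[of ?U c 1 0] Uc by simp
  ultimately show ?thesis
    using c by (simp add: four_acceleration_def cov_deriv_def christoffel_def partial_flat_metric
        vec_eq_iff)
qed

theorem theorem1:
  fixes c :: "real^4" and r :: real and B :: "(real^4) set"
  assumes "r > 0" and "B = ball c r"
  shows "\<not> (\<exists>F \<in> observer_independent_measures B.
    \<forall>g \<in> stationary_metrics B. \<forall>K \<in> timelike_killing_fields B g. \<forall>x \<in> B.
      four_acceleration g K x \<noteq> 0 \<longrightarrow> vf_deriv (four_acceleration g K) (F g) x < 0)"
proof
  let ?g = "flat_metric B"
  assume "\<exists>F \<in> observer_independent_measures B.
    \<forall>g \<in> stationary_metrics B. \<forall>K \<in> timelike_killing_fields B g. \<forall>x \<in> B.
      four_acceleration g K x \<noteq> 0 \<longrightarrow> vf_deriv (four_acceleration g K) (F g) x < 0"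
  then obtain F where F: "\<And>g K x. \<lbrakk>g \<in> stationary_metrics B; K \<in> timelike_killing_fields B g; x \<in> B;
      four_acceleration g K x \<noteq> 0\<rbrakk> \<Longrightarrow> vf_deriv (four_acceleration g K) (F g) x < 0"
    by blast
  \<comment> \<open>This gives \<open>s * r = 1/4\<close>, within the bound under which the boosted
    field is timelike on the whole ball, for either sign of the parameter.\<close>
  define s where "s = 1 / (4 * r)"
  have s: "s > 0" "s * r < 1 / 2"
    using assms(1) by (auto simp: s_def)
  have K: "restrict (boost c a) B \<in> timelike_killing_fields B ?g" if "\<bar>a\<bar> = s" for a
    using boost_timelike_killing that s assms(2) by simp
  have "?g \<in> stationary_metrics B"
    using K[of s] s assms(2) flat_metric_lorentzian[of B] by (auto simp: stationary_metrics_def)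
  moreover have A: "four_acceleration ?g (restrict (boost c a) B) c = a *\<^sub>R axis 1 1" for a
    using boost_four_acceleration assms by simp
  moreover have "vf_deriv (four_acceleration ?g (restrict (boost c a) B)) f c = a * partial 1 f c" for a f
    by (rule vf_deriv_axis) (rule A)
  ultimately have "a * partial 1 (F ?g) c < 0" if "\<bar>a\<bar> = s" for a
    using F[OF _ K[OF that], of c] that s assms
    by (auto simp: axis_eq_0_iff)
  \<comment> \<open>Both fields belong to the same metric, hence to the same scalar field
    \<open>F ?g\<close>: its \<open>x\<close> derivative at \<open>c\<close> would have to be
    negative and positive at once.\<close>
  from this[of s] this[of "- s"] show False
    using s by simp
qed

end
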